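(* Let $n,k$ be integers with $1\le k\le n$, and let $S_{n+1}=K_{1,n}$ be the star graph on $n+1$ vertices. Then the $k$-token graph $F_k(S_{n+1})$ is isomorphic to the doubled Johnson graph $J(n;k-1,k)$.
   Context: All graphs are finite and simple. For a graph $G$ with $N$ vertices and $1\le k\le N$, the $k$-token graph $F_k(G)$ has as vertices the $k$-subsets of $V(G)$; two vertices $A,B$ are adjacent iff $A\bigtriangleup B=\{a,b\}$ with $a\in A$, $b\in B$ and $\{a,b\}$ an edge of $G$. The doubled Johnson graph $J(n;k-1,k)$ is the bipartite graph whose vertices are the $(k-1)$-subsets and the $k$-subsets of $[n]=\{1,\dots,n\}$, where distinct vertices $u,v$ are adjacent iff $u\subset v$ or $v\subset u$. *)

theory Defs
  imports "Graph_Theory.Graph_Theory"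
begin

text \<open>
  A finite simple graph is represented, as in the locale \<^locale>\<open>graph\<close>, by a finite loop-free
  symmetric digraph without parallel arcs: an undirected edge \<open>{a, b}\<close> is the pair of arcs
  \<open>(a, b)\<close>, \<open>(b, a)\<close>. Between such graphs, \<^const>\<open>digraph_iso\<close> is isomorphism of simple graphs.
\<close>

definition token_graph :: "nat \<Rightarrow> ('a, 'b) pre_digraph \<Rightarrow> 'a set pair_pre_digraph" where
  "token_graph k G =
    (let V = {A. A \<subseteq> verts G \<and> card A = k} in
      \<lparr> pverts = V,
        parcs = {(A, B). A \<in> V \<and> B \<in> V \<and>
          (\<exists>a\<in>A. \<exists>b\<in>B. (A - B) \<union> (B - A) = {a, b} \<and> (a, b) \<in> arcs_ends G)} \<rparr>)"

text \<open>Only meaningful for \<open>k \<ge> 1\<close>, since \<open>k - 1\<close> is truncated subtraction.\<close>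

definition doubled_johnson_graph :: "nat \<Rightarrow> nat \<Rightarrow> nat set pair_pre_digraph" where
  "doubled_johnson_graph n k =
    (let V = {A. A \<subseteq> {1..n} \<and> (card A = k - 1 \<or> card A = k)} in
      \<lparr> pverts = V,
        parcs = {(u, v). u \<in> V \<and> v \<in> V \<and> u \<noteq> v \<and> (u \<subseteq> v \<or> v \<subseteq> u)} \<rparr>)"

lemma pair_graphI:
  assumes "finite (pverts G)" and "parcs G \<subseteq> pverts G \<times> pverts G"
    and "\<And>u v. (u, v) \<in> parcs G \<Longrightarrow> (v, u) \<in> parcs G"
    and "\<And>u. (u, u) \<notin> parcs G"
  shows "pair_graph G"
proof unfold_locales
  show "finite (parcs G)"
    using finite_subset[OF assms(2)] assms(1) by blast
  show "symmetric (with_proj G)"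
    unfolding symmetric_def with_proj_simps by (rule symI) (rule assms(3))
  show "fst e \<in> pverts G" "snd e \<in> pverts G" "fst e \<noteq> snd e" if "e \<in> parcs G" for e
    using that assms(2,4) by (cases e; fastforce)+
qed (rule assms(1))

lemma pair_graph_token_graph:
  assumes "graph G"
  shows "pair_graph (token_graph k G)"
proof (rule pair_graphI)
  interpret graph G by (rule assms)
  have "pverts (token_graph k G) \<subseteq> Pow (verts G)"
    unfolding token_graph_def Let_def by (simp, blast)
  then show "finite (pverts (token_graph k G))"
    by (rule finite_subset) simp
  show "parcs (token_graph k G) \<subseteq> pverts (token_graph k G) \<times> pverts (token_graph k G)"
    unfolding token_graph_def Let_def by (simp, blast)
  show "(A, A) \<notin> parcs (token_graph k G)" for A
    unfolding token_graph_def Let_def by simp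
  show "(B, A) \<in> parcs (token_graph k G)" if "(A, B) \<in> parcs (token_graph k G)" for A B
  proof -
    from that obtain a b where V: "A \<subseteq> verts G" "card A = k" "B \<subseteq> verts G" "card B = k"
      and ab: "a \<in> A" "b \<in> B" and D: "(A - B) \<union> (B - A) = {a, b}"
      and E: "(a, b) \<in> arcs_ends G"
      unfolding token_graph_def Let_def by (simp, blast)
    have "(b, a) \<in> arcs_ends G"
      using E sym_arcs unfolding symmetric_def by (rule symD[rotated])
    moreover have "(B - A) \<union> (A - B) = {b, a}"
      using D by (simp only: Un_commute insert_commute)
    ultimately have "\<exists>b\<in>B. \<exists>a\<in>A. (B - A) \<union> (A - B) = {b, a} \<and> (b, a) \<in> arcs_ends G"
      using ab by (intro bexI conjI)
    with V show ?thesis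
      unfolding token_graph_def Let_def by simp
  qed
qed

lemma pair_graph_doubled_johnson_graph: "pair_graph (doubled_johnson_graph n k)"
proof (rule pair_graphI)
  have "pverts (doubled_johnson_graph n k) \<subseteq> Pow {1..n}"
    unfolding doubled_johnson_graph_def Let_def by (simp, blast)
  then show "finite (pverts (doubled_johnson_graph n k))"
    by (rule finite_subset) simp
qed (unfold doubled_johnson_graph_def Let_def, (simp, blast?)+)

end

(* A k-subset of the star is determined by its set of occupied leaves, which has k - 1 or k
   elements according to whether the centre is occupied or not. A token moves along an edge exactly
   when it enters or leaves the centre, that is, when one leaf leaves or enters this set. *)
theory Submission
  imports Defs
begin

text \<open>Arcs here are pairs of vertices, so a vertex map \<open>f\<close> determines its arc map
  \<open>map_prod f f\<close>, which inherits injectivity from \<open>f\<close>. The equivalence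
  \<open>adj\<close> then makes the arcs of \<open>H\<close> exactly the image of those of
  \<open>G\<close>.\<close>

lemma digraph_iso_with_projI:
  assumes "pair_wf_digraph G" and "pair_wf_digraph H"
    and bij: "bij_betw f (pverts G) (pverts H)"
    and adj: "\<And>u v. u \<in> pverts G \<Longrightarrow> v \<in> pverts G \<Longrightarrow> (u, v) \<in> parcs G \<longleftrightarrow> (f u, f v) \<in> parcs H"
  shows "digraph_iso (with_proj G) (with_proj H)"
proof -
  interpret G: pair_wf_digraph G by (rule assms)
  interpret H: pair_wf_digraph H by (rule assms)
  define h where "h = \<lparr>iso_verts = f, iso_arcs = map_prod f f, iso_head = snd, iso_tail = fst\<rparr>"
  have inj: "inj_on f (pverts G)" and im: "f ` pverts G = pverts H"
    using bij by (auto simp: bij_betw_def)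
  have sub: "parcs G \<subseteq> pverts G \<times> pverts G"
    by (auto dest: G.wellformed')
  have "inj_on (map_prod f f) (parcs G)"
    using map_prod_inj_on[OF inj inj] sub by (rule inj_on_subset)
  then have "pre_digraph.digraph_isomorphism (with_proj G) h"
    using inj G.wf_digraph_axioms by (simp add: pre_digraph.digraph_isomorphism_def h_def)
  moreover have "parcs H = map_prod f f ` parcs G"
  proof (intro equalityI subrelI)
    fix x y assume xy: "(x, y) \<in> parcs H"
    \<comment> \<open>Both ends of an arc of \<open>H\<close> are vertices of \<open>H\<close>, so
      they have preimages, and \<open>adj\<close> can be read backwards.\<close>
    then obtain u v where "u \<in> pverts G" "v \<in> pverts G" "x = f u" "y = f v"
      using im H.wellformed' by (metis imageE)
    with xy adj show "(x, y) \<in> map_prod f f ` parcs G" by force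
  next
    fix x y assume "(x, y) \<in> map_prod f f ` parcs G"
    then show "(x, y) \<in> parcs H" using adj sub by auto
  qed
  then have "with_proj H = app_iso h (with_proj G)"
    by (simp add: app_iso_def h_def with_proj_def im)
  ultimately show ?thesis
    unfolding digraph_iso_def by blast
qed

text \<open>The size of \<open>B\<close> reveals whether the centre was occupied, which gives the
  inverse map: a set of size \<open>k\<close> is kept, and one of size \<open>k - 1\<close> gets
  \<open>c\<close> back.\<close>

lemma bij_betw_Diff_center:
  assumes "c \<notin> V" and "finite V" and "1 \<le> k"
  shows "bij_betw (\<lambda>A. A - {c}) {A. A \<subseteq> insert c V \<and> card A = k}
    {B. B \<subseteq> V \<and> (card B = k - 1 \<or> card B = k)}"
proof (rule bij_betwI[where g = "\<lambda>B. if card B = k then B else insert c B"])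
  show "(\<lambda>A. A - {c}) \<in> {A. A \<subseteq> insert c V \<and> card A = k} \<rightarrow>
      {B. B \<subseteq> V \<and> (card B = k - 1 \<or> card B = k)}"
    by (auto simp: card_Diff_singleton_if)
  show "(\<lambda>B. if card B = k then B else insert c B) \<in>
      {B. B \<subseteq> V \<and> (card B = k - 1 \<or> card B = k)} \<rightarrow> {A. A \<subseteq> insert c V \<and> card A = k}"
  proof
    fix B assume B: "B \<in> {B. B \<subseteq> V \<and> (card B = k - 1 \<or> card B = k)}"
    then have "finite B" "c \<notin> B" using assms by (auto intro: finite_subset)
    with B assms show "(if card B = k then B else insert c B) \<in> {A. A \<subseteq> insert c V \<and> card A = k}"
      by auto
  qed
  show "(if card (A - {c}) = k then A - {c} else insert c (A - {c})) = A"
    if "A \<in> {A. A \<subseteq> insert c V \<and> card A = k}" for A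
    using that assms by (auto simp: card_Diff_singleton_if)
  show "(if card B = k then B else insert c B) - {c} = B"
    if "B \<in> {B. B \<subseteq> V \<and> (card B = k - 1 \<or> card B = k)}" for B
    using that assms by auto
qed

text \<open>As \<open>A\<close> and \<open>B\<close> have equal size, deleting \<open>c\<close> can
  leave less of \<open>A\<close> than of \<open>B\<close> only if \<open>c\<close> lies in
  \<open>A\<close> but not in \<open>B\<close>. The remainders then differ by a single element
  \<open>b\<close>, the leaf to which the token at \<open>c\<close> moves.\<close>

lemma psubset_Diff_center_iff:
  assumes "finite A" and "finite B" and "card A = card B"
  shows "A - {c} \<subset> B - {c} \<longleftrightarrow>
    c \<in> A \<and> (\<exists>b\<in>B. b \<noteq> c \<and> (A - B) \<union> (B - A) = {c, b})"
proof
  assume L: "A - {c} \<subset> B - {c}"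
  then have lt: "card (A - {c}) < card (B - {c})"
    using assms by (intro psubset_card_mono) auto
  then have c: "c \<in> A" "c \<notin> B"
    using assms by (auto simp: card_Diff_singleton_if split: if_splits)
  have "card (B - (A - {c})) = card B - card (A - {c})"
    using L assms by (intro card_Diff_subset) auto
  \<comment> \<open>Here \<open>card (A - {c})\<close> is \<open>card B - 1\<close>, and
    \<open>lt\<close> ensures that this truncated subtraction really decreases.\<close>
  also have "\<dots> = 1"
    using lt c assms by simp
  finally obtain b where "B - (A - {c}) = {b}"
    by (auto simp: card_1_singleton_iff)
  with L c show "c \<in> A \<and> (\<exists>b\<in>B. b \<noteq> c \<and> (A - B) \<union> (B - A) = {c, b})"
    by (intro conjI bexI[of _ b]) auto
next
  assume "c \<in> A \<and> (\<exists>b\<in>B. b \<noteq> c \<and> (A - B) \<union> (B - A) = {c, b})"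
  then obtain b where c: "c \<in> A" and b: "b \<in> B" "b \<noteq> c" and D: "(A - B) \<union> (B - A) = {c, b}"
    by blast
  have "b \<notin> A"
    using b D by blast
  moreover have "A - {c} \<subseteq> B"
  proof
    fix x assume x: "x \<in> A - {c}"
    show "x \<in> B"
    proof (rule ccontr)
      assume "x \<notin> B"
      with x D have "x = b" by blast
      with b \<open>x \<notin> B\<close> show False by simp
    qed
  qed
  ultimately show "A - {c} \<subset> B - {c}"
    using b by blast
qed

text \<open>Every edge of the star contains \<open>c\<close>, so a token either leaves the centre or
  enters it. These two cases are the preceding lemma and its mirror image with \<open>A\<close> and
  \<open>B\<close> exchanged.\<close>

lemma star_token_adjacent_iff:
  assumes "c \<notin> V" and "finite V" and "A \<subseteq> insert c V" and "B \<subseteq> insert c V" and "card A = card B"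
  shows "(\<exists>a\<in>A. \<exists>b\<in>B. (A - B) \<union> (B - A) = {a, b} \<and> (a, b) \<in> {c} \<times> V \<union> V \<times> {c}) \<longleftrightarrow>
    A - {c} \<subset> B - {c} \<or> B - {c} \<subset> A - {c}"
proof -
  have fin: "finite A" "finite B"
    using assms by (auto intro: finite_subset)
  have split: "(\<exists>a\<in>A. \<exists>b\<in>B. P a b \<and> (a = c \<and> b \<noteq> c \<or> b = c \<and> a \<noteq> c)) \<longleftrightarrow>
      (c \<in> A \<and> (\<exists>b\<in>B. b \<noteq> c \<and> P c b)) \<or> (c \<in> B \<and> (\<exists>a\<in>A. a \<noteq> c \<and> P a c))" for P
    by blast
  have swap: "(A - B) \<union> (B - A) = {a, c} \<longleftrightarrow> (B - A) \<union> (A - B) = {c, a}" for a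
    by (simp only: Un_commute insert_commute)
  \<comment> \<open>For elements of \<open>A\<close> and \<open>B\<close>, lying in \<open>V\<close>
    means being different from \<open>c\<close>; this brings the edge condition into the form that
    \<open>split\<close> handles.\<close>
  have "(\<exists>a\<in>A. \<exists>b\<in>B. (A - B) \<union> (B - A) = {a, b} \<and> (a, b) \<in> {c} \<times> V \<union> V \<times> {c}) \<longleftrightarrow>
      (\<exists>a\<in>A. \<exists>b\<in>B. (A - B) \<union> (B - A) = {a, b} \<and> (a = c \<and> b \<noteq> c \<or> b = c \<and> a \<noteq> c))"
    using assms(1,3,4) by (intro bex_cong conj_cong refl) auto
  then show ?thesis
    by (simp only: split swap psubset_Diff_center_iff[OF fin assms(5)]
        psubset_Diff_center_iff[OF fin(2,1) assms(5)[symmetric]])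
qed

theorem mainTheorem7:
  fixes n k :: nat and S :: "('a, 'b) pre_digraph"
  assumes "1 \<le> k" and "k \<le> n"
    and "complete_bipartite_digraph 1 n S"
  shows "digraph_iso (with_proj (token_graph k S)) (with_proj (doubled_johnson_graph n k))"
proof -
  have "graph S"
    using assms(3) by (simp add: complete_bipartite_digraph_def)
  obtain U V where UV: "verts S = U \<union> V" "U \<inter> V = {}" "card U = 1" "card V = n"
      "arcs_ends S = U \<times> V \<union> V \<times> U"
    using assms(3) unfolding complete_bipartite_digraph_def by blast
  then obtain c where "U = {c}"
    by (auto simp: card_1_singleton_iff)
  with UV have S: "verts S = insert c V" "c \<notin> V" "arcs_ends S = {c} \<times> V \<union> V \<times> {c}"
    by auto
  \<comment> \<open>An infinite set has \<open>card\<close> 0, whereas \<open>n\<close> is positive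
    because \<open>1 \<le> k\<close> and \<open>k \<le> n\<close>.\<close>
  have "finite V"
    using UV(4) assms by (intro card_ge_0_finite) simp
  then obtain g where g: "bij_betw g V {1..n}"
    using finite_same_card_bij[of V "{1..n}"] UV(4) by auto
  then have inj: "inj_on g V" and im: "g ` V = {1..n}"
    by (auto simp: bij_betw_def)
  have card_im: "card (g ` B) = card B" if "B \<subseteq> V" for B
    using that inj by (meson card_image inj_on_subset)
  \<comment> \<open>Writing inclusion as \<open>B \<union> C = C\<close> reduces the claim to
    equality of images, where injectivity of \<open>g\<close> applies.\<close>
  have psubset_im: "g ` B \<subset> g ` C \<longleftrightarrow> B \<subset> C" if "B \<subseteq> V" "C \<subseteq> V" for B C
    using that by (simp add: psubset_eq subset_Un_eq[of "g ` B"] subset_Un_eq[of B C]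
        image_Un[symmetric] inj_on_image_eq_iff[OF inj])
  have bij_im: "bij_betw ((`) g) {B. B \<subseteq> V \<and> (card B = k - 1 \<or> card B = k)}
      {B. B \<subseteq> {1..n} \<and> (card B = k - 1 \<or> card B = k)}"
    (is "bij_betw _ ?X ?Y")
  proof (rule bij_betw_imageI)
    show "inj_on ((`) g) ?X"
      using inj by (auto simp: inj_on_def inj_on_image_eq_iff)
    show "((`) g) ` ?X = ?Y"
    proof (intro equalityI subsetI)
      fix B assume B: "B \<in> ?Y"
      then obtain C where "C \<subseteq> V" "B = g ` C"
        using im by (metis (mono_tags, lifting) mem_Collect_eq subset_imageE)
      with B card_im show "B \<in> (`) g ` ?X" by auto
    qed (use im card_im in auto)
  qed
  have graphs: "pair_graph (token_graph k S)" "pair_graph (doubled_johnson_graph n k)"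
    by (rule pair_graph_token_graph[OF \<open>graph S\<close>], rule pair_graph_doubled_johnson_graph)
  \<comment> \<open>The isomorphism: forget the centre, then rename the occupied leaves to numbers
    by \<open>g\<close>.\<close>
  let ?f = "\<lambda>A. g ` (A - {c})"
  have bij: "bij_betw ?f (pverts (token_graph k S)) (pverts (doubled_johnson_graph n k))"
    using bij_betw_trans[OF bij_betw_Diff_center[OF S(2) \<open>finite V\<close> assms(1)] bij_im]
    by (simp add: token_graph_def doubled_johnson_graph_def S(1) comp_def)
  have adj: "(A, B) \<in> parcs (token_graph k S) \<longleftrightarrow>
      (?f A, ?f B) \<in> parcs (doubled_johnson_graph n k)"
    if AB: "A \<in> pverts (token_graph k S)" "B \<in> pverts (token_graph k S)" for A B
  proof -
    have AB': "A \<subseteq> insert c V" "B \<subseteq> insert c V" "card A = k" "card B = k"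
      using AB by (auto simp: token_graph_def S(1))
    then have sub: "A - {c} \<subseteq> V" "B - {c} \<subseteq> V"
      by auto
    have f_in: "?f A \<in> pverts (doubled_johnson_graph n k)" "?f B \<in> pverts (doubled_johnson_graph n k)"
      using AB bij by (auto dest: bij_betwE)
    \<comment> \<open>Distinct and comparable means strictly comparable, the form in which token
      moves were described.\<close>
    have johnson_adj: "(X, Y) \<in> parcs (doubled_johnson_graph n k) \<longleftrightarrow> X \<subset> Y \<or> Y \<subset> X"
      if "X \<in> pverts (doubled_johnson_graph n k)" "Y \<in> pverts (doubled_johnson_graph n k)" for X Y
      using that by (simp add: doubled_johnson_graph_def psubset_eq) blast
    have "(?f A, ?f B) \<in> parcs (doubled_johnson_graph n k) \<longleftrightarrow> ?f A \<subset> ?f B \<or> ?f B \<subset> ?f A"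
      using f_in by (rule johnson_adj)
    also have "\<dots> \<longleftrightarrow> A - {c} \<subset> B - {c} \<or> B - {c} \<subset> A - {c}"
      by (simp only: psubset_im sub)
    also have "\<dots> \<longleftrightarrow> (A, B) \<in> parcs (token_graph k S)"
      unfolding star_token_adjacent_iff[OF S(2) \<open>finite V\<close> AB'(1,2) trans[OF AB'(3) AB'(4)[symmetric]],
          symmetric]
      using AB by (simp add: token_graph_def S(3))
    finally show ?thesis by simp
  qed
  have "pair_wf_digraph (token_graph k S)" "pair_wf_digraph (doubled_johnson_graph n k)"
    using graphs by (simp_all add: pair_graph_def pair_digraph_def pair_fin_digraph_def)
  then show ?thesis
    using bij adj by (rule digraph_iso_with_projI)
qed

end
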